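(* If Seymour's second neighbourhood conjecture is false (i.e. if there exists at least one counterexample to it), then there exists $k\in\mathbb{N}$ such that there are infinitely many (pairwise non-isomorphic) counterexamples $O$ whose minimum out-degree is at least $\frac{|V(O)|}{2}-k$.
   Context: All directed graphs are finite, with non-empty vertex set, and without loops or multiple arcs. An orientation is a directed graph with no directed cycle of length 2. For a directed graph $G$ and $v\in V(G)$, $N_1(G,v)=\{w : (v,w)\in E(G)\}$ and $N_2(G,v)=\{w\in V(G)\setminus(N_1(G,v)\cup\{v\}) : \exists u\in N_1(G,v),\ (u,w)\in E(G)\}$. Seymour's second neighbourhood conjecture states that every orientation $G$ contains a vertex $v$ with $|N_2(G,v)|\ge |N_1(G,v)|$. A counterexample is an orientation $O$ with $|N_1(O,v)|>|N_2(O,v)|$ for all $v\in V(O)$. The minimum out-degree of $O$ is $\min_{v}|N_1(O,v)|$. *)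

theory Defs
  imports Complex_Main "Graph_Theory.Pair_Digraph" "Graph_Theory.Digraph_Isomorphism"
begin

definition out_nbrs :: "'a pair_pre_digraph \<Rightarrow> 'a \<Rightarrow> 'a set" ("N\<^sub>1") where
  "N\<^sub>1 G v = {w. (v, w) \<in> parcs G}"

definition second_out_nbrs :: "'a pair_pre_digraph \<Rightarrow> 'a \<Rightarrow> 'a set" ("N\<^sub>2") where
  "N\<^sub>2 G v = {w \<in> pverts G - (N\<^sub>1 G v \<union> {v}). \<exists>u \<in> N\<^sub>1 G v. (u, w) \<in> parcs G}"

text \<open>The library's digraphs may be null graphs, so non-emptiness is required separately.
  Multiple arcs are excluded because the arcs are a set of pairs.\<close>

definition orientation :: "'a pair_pre_digraph \<Rightarrow> bool" where
  "orientation G \<longleftrightarrow> pair_digraph G \<and> pverts G \<noteq> {} \<and>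
     \<not> (\<exists>u v. (u, v) \<in> parcs G \<and> (v, u) \<in> parcs G)"

text \<open>HOL cannot quantify over types inside a formula, so the conjecture takes the type of
  the vertices as a parameter.\<close>

definition seymour_conjecture :: "'a itself \<Rightarrow> bool" where
  "seymour_conjecture _ \<longleftrightarrow> (\<forall>G :: 'a pair_pre_digraph. orientation G \<longrightarrow>
     (\<exists>v \<in> pverts G. card (N\<^sub>2 G v) \<ge> card (N\<^sub>1 G v)))"

definition counterexample :: "'a pair_pre_digraph \<Rightarrow> bool" where
  "counterexample G \<longleftrightarrow> orientation G \<and> (\<forall>v \<in> pverts G. card (N\<^sub>1 G v) > card (N\<^sub>2 G v))"

lemma not_seymour_conjecture_iff:
  "\<not> seymour_conjecture TYPE('a) \<longleftrightarrow> (\<exists>G :: 'a pair_pre_digraph. counterexample G)"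
  by (auto simp: seymour_conjecture_def counterexample_def not_le)

definition min_out_degree :: "'a pair_pre_digraph \<Rightarrow> nat" where
  "min_out_degree G = Min ((\<lambda>v. card (N\<^sub>1 G v)) ` pverts G)"

text \<open>On pair digraphs, the library's isomorphism (which also maps arcs, and requires
  equality of the head and tail functions) is the usual one.\<close>

lemma digraph_iso_with_proj_iff:
  assumes "pair_wf_digraph G" "pair_wf_digraph H"
  shows "digraph_iso (with_proj G) (with_proj H) \<longleftrightarrow>
    (\<exists>f. bij_betw f (pverts G) (pverts H) \<and>
      (\<forall>u \<in> pverts G. \<forall>v \<in> pverts G. (u, v) \<in> parcs G \<longleftrightarrow> (f u, f v) \<in> parcs H))"
    (is "?L \<longleftrightarrow> (\<exists>f. ?R f)")
proof
  interpret G: pair_wf_digraph G by fact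
  interpret H: pair_wf_digraph H by fact
  {
    assume ?L
    then obtain h where h: "pre_digraph.digraph_isomorphism (with_proj G) h"
      and H: "with_proj H = app_iso h (with_proj G)"
      by (auto simp: digraph_iso_def)
    let ?f = "iso_verts h"
    have verts: "pverts H = ?f ` pverts G" and arcs: "parcs H = iso_arcs h ` parcs G"
      and ht: "iso_tail h = fst" "iso_head h = snd"
      using H by (simp_all add: app_iso_def with_proj_def)
    have inj: "inj_on ?f (pverts G)"
      using h by (simp add: pre_digraph.digraph_isomorphism_def)
    have ia: "iso_arcs h a = (?f (fst a), ?f (snd a))" if "a \<in> parcs G" for a
      using h that by (simp add: pre_digraph.digraph_isomorphism_def ht prod_eq_iff)
    have "(u, v) \<in> parcs G \<longleftrightarrow> (?f u, ?f v) \<in> parcs H"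
      if uv: "u \<in> pverts G" "v \<in> pverts G" for u v
    proof
      assume "(u, v) \<in> parcs G"
      then show "(?f u, ?f v) \<in> parcs H" using ia arcs by force
    next
      assume "(?f u, ?f v) \<in> parcs H"
      then obtain x y where xy: "(x, y) \<in> parcs G" "?f x = ?f u" "?f y = ?f v"
        using ia arcs by force
      then have "x \<in> pverts G" "y \<in> pverts G" using G.in_arcsD1 G.in_arcsD2 by blast+
      then have "x = u" "y = v" using xy uv inj by (auto dest: inj_onD)
      then show "(u, v) \<in> parcs G" using xy by simp
    qed
    then show "\<exists>f. ?R f" using inj verts by (auto simp: bij_betw_def)
  }
  {
    assume "\<exists>f. ?R f"
    then obtain f where bij: "bij_betw f (pverts G) (pverts H)"
      and e: "\<And>u v. u \<in> pverts G \<Longrightarrow> v \<in> pverts G \<Longrightarrow> (u, v) \<in> parcs G \<longleftrightarrow> (f u, f v) \<in> parcs H"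
      by blast
    have inj: "inj_on f (pverts G)" and im: "f ` pverts G = pverts H"
      using bij by (auto simp: bij_betw_def)
    let ?h = "\<lparr>iso_verts = f, iso_arcs = map_prod f f, iso_head = snd, iso_tail = fst\<rparr>"
    have "inj_on (map_prod f f) (parcs G)"
      by (rule inj_on_subset[OF map_prod_inj_on[OF inj inj]])
        (use G.in_arcsD1 G.in_arcsD2 in force)
    then have "pre_digraph.digraph_isomorphism (with_proj G) ?h"
      using inj G.wf_digraph by (auto simp: pre_digraph.digraph_isomorphism_def)
    moreover have "parcs H = map_prod f f ` parcs G"
    proof (intro set_eqI iffI)
      fix a assume a: "a \<in> parcs H"
      obtain x y where xy: "a = (x, y)" by (cases a)
      with a have "x \<in> f ` pverts G" "y \<in> f ` pverts G"
        using H.in_arcsD1 H.in_arcsD2 im by blast+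
      then obtain u v where "u \<in> pverts G" "v \<in> pverts G" "x = f u" "y = f v" by blast
      then have "(u, v) \<in> parcs G" "a = map_prod f f (u, v)" using a xy e by simp_all
      then show "a \<in> map_prod f f ` parcs G" by blast
    next
      fix a assume "a \<in> map_prod f f ` parcs G"
      then obtain u v where uv: "(u, v) \<in> parcs G" and a: "a = (f u, f v)" by auto
      then have "u \<in> pverts G" "v \<in> pverts G" using G.in_arcsD1 G.in_arcsD2 by blast+
      then show "a \<in> parcs H" using e uv a by blast
    qed
    then have "with_proj H = app_iso ?h (with_proj G)"
      using im by (simp add: app_iso_def with_proj_def)
    ultimately show ?L by (auto simp: digraph_iso_def)
  }
qed

end

theory Submission
  imports Defs
begin

text \<open>Let \<open>G\<close> be a counterexample with \<open>m\<close> vertices and substitute a copy of \<open>G\<close> for each vertex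
  of a regular tournament with \<open>2 * r + 1\<close> vertices. Outside its own copy of \<open>G\<close>, each vertex has
  \<open>m * r\<close> out-neighbours, which leaves at most \<open>m * r\<close> second out-neighbours there. Inside its copy
  nothing changes, since the tournament has no directed 2-cycle through which a vertex could
  return to its own copy. So the result is a counterexample, with out-degrees at least \<open>m * r\<close> on
  \<open>m * (2 * r + 1)\<close> vertices, and \<open>k = m\<close> works for all \<open>r\<close>.\<close>

section \<open>Orientations in elementary terms\<close>

lemma orientationI:
  assumes "finite (pverts G)" "pverts G \<noteq> {}" "parcs G \<subseteq> pverts G \<times> pverts G"
    and "\<And>u v. (u, v) \<in> parcs G \<Longrightarrow> (v, u) \<notin> parcs G"
  shows "orientation G"
proof -
  have "finite (parcs G)"
    using assms(1,3) by (meson finite_SigmaI finite_subset)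
  \<comment> \<open>Absence of loops is the last premise at \<open>u = v\<close>.\<close>
  with assms have "pair_digraph G"
    by unfold_locales force+
  with assms show ?thesis
    by (auto simp: orientation_def)
qed

lemma orientationD:
  assumes "orientation G"
  shows "finite (pverts G)" "pverts G \<noteq> {}" "parcs G \<subseteq> pverts G \<times> pverts G"
    and "\<And>u v. (u, v) \<in> parcs G \<Longrightarrow> (v, u) \<notin> parcs G"
proof -
  interpret pair_digraph G
    using assms by (simp add: orientation_def)
  show "finite (pverts G)" "pverts G \<noteq> {}" "parcs G \<subseteq> pverts G \<times> pverts G"
    and "\<And>u v. (u, v) \<in> parcs G \<Longrightarrow> (v, u) \<notin> parcs G"
    using assms in_arcsD1 in_arcsD2 by (auto simp: orientation_def)
qed

lemma out_nbrs_subset: "orientation G \<Longrightarrow> N\<^sub>1 G v \<subseteq> pverts G"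
  using orientationD(3) by (fastforce simp: out_nbrs_def)

lemma second_out_nbrs_subset: "N\<^sub>2 G v \<subseteq> pverts G"
  by (auto simp: second_out_nbrs_def)

lemma counterexample_imp_orientation: "counterexample G \<Longrightarrow> orientation G"
  by (simp add: counterexample_def)

lemma min_out_degree_geI:
  assumes "orientation G" "\<And>v. v \<in> pverts G \<Longrightarrow> d \<le> card (N\<^sub>1 G v)"
  shows "d \<le> min_out_degree G"
  using assms orientationD(1,2)[OF assms(1)] by (simp add: min_out_degree_def)


section \<open>Relabelling\<close>

text \<open>For \<open>f\<close> injective on the vertices this is an isomorphic copy; it serves to
  move the product to vertices in \<open>nat\<close>.\<close>

definition relabel :: "('a \<Rightarrow> 'b) \<Rightarrow> 'a pair_pre_digraph \<Rightarrow> 'b pair_pre_digraph" where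
  "relabel f G = \<lparr>pverts = f ` pverts G, parcs = map_prod f f ` parcs G\<rparr>"

context
  fixes G :: "'a pair_pre_digraph" and f :: "'a \<Rightarrow> 'b"
  assumes G: "orientation G" and inj: "inj_on f (pverts G)"
begin

lemma arc_relabel_iff:
  assumes "u \<in> pverts G" "v \<in> pverts G"
  shows "(f u, f v) \<in> parcs (relabel f G) \<longleftrightarrow> (u, v) \<in> parcs G"
proof
  assume "(f u, f v) \<in> parcs (relabel f G)"
  then obtain a b where ab: "(a, b) \<in> parcs G" "f a = f u" "f b = f v"
    by (auto simp: relabel_def)
  with orientationD(3)[OF G] have "a \<in> pverts G" "b \<in> pverts G"
    by auto
  with ab assms inj show "(u, v) \<in> parcs G"
    by (auto dest: inj_onD)
qed (force simp: relabel_def)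

lemma relabel_arcE:
  assumes "(a, b) \<in> parcs (relabel f G)"
  obtains u v where "u \<in> pverts G" "v \<in> pverts G" "a = f u" "b = f v" "(u, v) \<in> parcs G"
  using assms orientationD(3)[OF G] by (auto simp: relabel_def)

lemma pverts_relabel: "pverts (relabel f G) = f ` pverts G"
  by (simp add: relabel_def)

lemma orientation_relabel: "orientation (relabel f G)"
proof (rule orientationI)
  fix a b assume "(a, b) \<in> parcs (relabel f G)"
  then show "(b, a) \<notin> parcs (relabel f G)"
    by (elim relabel_arcE) (simp add: arc_relabel_iff orientationD(4)[OF G])
qed (use orientationD(1,2)[OF G] in \<open>auto simp: pverts_relabel elim!: relabel_arcE\<close>)

lemma out_nbrs_relabel:
  assumes "v \<in> pverts G"
  shows "N\<^sub>1 (relabel f G) (f v) = f ` N\<^sub>1 G v"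
proof -
  have "w \<in> f ` N\<^sub>1 G v" if "(f v, w) \<in> parcs (relabel f G)" for w
    using that by (rule relabel_arcE) (use assms inj in \<open>auto simp: out_nbrs_def dest: inj_onD\<close>)
  moreover have "(f v, f w) \<in> parcs (relabel f G)" if "(v, w) \<in> parcs G" for w
    using that by (force simp: relabel_def)
  ultimately show ?thesis
    unfolding out_nbrs_def by blast
qed

lemma second_out_nbrs_relabel:
  assumes v: "v \<in> pverts G"
  shows "N\<^sub>2 (relabel f G) (f v) = f ` N\<^sub>2 G v"
proof -
  \<comment> \<open>Both sides lie in the image of \<open>pverts G\<close> under \<open>f\<close>,
    so comparing membership of \<open>f w\<close> suffices.\<close>
  have "f w \<in> N\<^sub>2 (relabel f G) (f v) \<longleftrightarrow> w \<in> N\<^sub>2 G v" if w: "w \<in> pverts G" for w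
  proof -
    have "f w = f v \<longleftrightarrow> w = v"
      using inj v w by (auto dest: inj_onD)
    moreover have "f w \<in> N\<^sub>1 (relabel f G) (f v) \<longleftrightarrow> w \<in> N\<^sub>1 G v"
      using v w by (simp add: out_nbrs_def arc_relabel_iff)
    moreover have "(\<exists>u \<in> N\<^sub>1 (relabel f G) (f v). (u, f w) \<in> parcs (relabel f G)) \<longleftrightarrow>
        (\<exists>u \<in> N\<^sub>1 G v. (u, w) \<in> parcs G)"
      using w out_nbrs_subset[OF G] by (auto simp: out_nbrs_relabel[OF v] arc_relabel_iff subset_iff)
    ultimately show ?thesis
      using w by (auto simp: second_out_nbrs_def pverts_relabel)
  qed
  then show ?thesis
    using second_out_nbrs_subset[of G v] second_out_nbrs_subset[of "relabel f G" "f v"]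
    by (auto simp: pverts_relabel)
qed

lemma card_out_nbrs_relabel:
  "v \<in> pverts G \<Longrightarrow> card (N\<^sub>1 (relabel f G) (f v)) = card (N\<^sub>1 G v)"
  by (simp add: out_nbrs_relabel card_image inj_on_subset[OF inj] out_nbrs_subset[OF G])

lemma card_second_out_nbrs_relabel:
  "v \<in> pverts G \<Longrightarrow> card (N\<^sub>2 (relabel f G) (f v)) = card (N\<^sub>2 G v)"
  by (simp add: second_out_nbrs_relabel card_image inj_on_subset[OF inj] second_out_nbrs_subset)

lemma counterexample_relabel:
  assumes "counterexample G"
  shows "counterexample (relabel f G)"
  using assms orientation_relabel
  by (auto simp: counterexample_def pverts_relabel card_out_nbrs_relabel card_second_out_nbrs_relabel)

lemma min_out_degree_relabel: "min_out_degree (relabel f G) = min_out_degree G"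
  by (simp add: min_out_degree_def pverts_relabel image_image card_out_nbrs_relabel cong: image_cong)

lemma card_pverts_relabel: "card (pverts (relabel f G)) = card (pverts G)"
  by (simp add: pverts_relabel card_image inj)

end


section \<open>The lexicographic product\<close>

text \<open>The first coordinate names the copy of \<open>G\<close>. For an orientation
  \<open>H\<close>, \<open>t\<close> is a vertex of \<open>H\<close> as the end of an arc or because
  \<open>t = s\<close>.\<close>

definition lex_product ::
    "'a pair_pre_digraph \<Rightarrow> 'b pair_pre_digraph \<Rightarrow> ('a \<times> 'b) pair_pre_digraph" where
  "lex_product H G = \<lparr>pverts = pverts H \<times> pverts G,
     parcs = {((s, x), (t, y)). s \<in> pverts H \<and> x \<in> pverts G \<and> y \<in> pverts G \<and>
       ((s, t) \<in> parcs H \<or> s = t \<and> (x, y) \<in> parcs G)}\<rparr>"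

lemma pverts_lex_product: "pverts (lex_product H G) = pverts H \<times> pverts G"
  by (simp add: lex_product_def)

context
  fixes H :: "'a pair_pre_digraph" and G :: "'b pair_pre_digraph"
  assumes H: "orientation H" and G: "orientation G"
begin

lemma orientation_lex_product: "orientation (lex_product H G)"
proof (rule orientationI)
  fix a b assume "(a, b) \<in> parcs (lex_product H G)"
  then show "(b, a) \<notin> parcs (lex_product H G)"
    using orientationD(4)[OF H] orientationD(4)[OF G] by (auto simp: lex_product_def)
qed (use orientationD(1-3)[OF H] orientationD(1-3)[OF G] in \<open>auto simp: lex_product_def\<close>)

lemma out_nbrs_lex_product:
  assumes "s \<in> pverts H" "x \<in> pverts G"
  shows "N\<^sub>1 (lex_product H G) (s, x) = N\<^sub>1 H s \<times> pverts G \<union> {s} \<times> N\<^sub>1 G x"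
  using assms orientationD(3)[OF G] by (auto simp: out_nbrs_def lex_product_def)

text \<open>The copies at out-neighbours of \<open>s\<close> consist entirely of out-neighbours of
  \<open>(s, x)\<close>. The bound is generous: it counts all vertices of the remaining copies,
  reachable in two steps or not.\<close>

lemma second_out_nbrs_lex_product_subset:
  assumes "s \<in> pverts H" "x \<in> pverts G"
  shows "N\<^sub>2 (lex_product H G) (s, x) \<subseteq> (pverts H - N\<^sub>1 H s - {s}) \<times> pverts G \<union> {s} \<times> N\<^sub>2 G x"
proof -
  have "y \<in> N\<^sub>2 G x" if y: "(s, y) \<in> N\<^sub>2 (lex_product H G) (s, x)" for y
  proof -
    obtain u where "u \<in> N\<^sub>1 (lex_product H G) (s, x)" "(u, (s, y)) \<in> parcs (lex_product H G)"
      using y by (auto simp: second_out_nbrs_def)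
    \<comment> \<open>A path that leaves the copy at \<open>s\<close> and returns would give a
      2-cycle of \<open>H\<close>, and \<open>H\<close> has no loops; so both arcs come from
      \<open>G\<close>.\<close>
    then have "\<exists>z \<in> N\<^sub>1 G x. (z, y) \<in> parcs G"
      using orientationD(4)[OF H] by (auto simp: out_nbrs_def lex_product_def)
    then show ?thesis
      using y assms by (auto simp: second_out_nbrs_def out_nbrs_lex_product pverts_lex_product)
  qed
  then show ?thesis
    using assms by (auto simp: second_out_nbrs_def out_nbrs_lex_product pverts_lex_product)
qed

lemma card_out_nbrs_lex_product:
  assumes "s \<in> pverts H" "x \<in> pverts G"
  shows "card (N\<^sub>1 (lex_product H G) (s, x)) = card (N\<^sub>1 H s) * card (pverts G) + card (N\<^sub>1 G x)"
proof -
  \<comment> \<open>No loops: \<open>orientationD(4)\<close> at \<open>u = v\<close>. This makes the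
    two parts of the out-neighbourhood disjoint.\<close>
  have "s \<notin> N\<^sub>1 H s"
    using orientationD(4)[OF H] by (auto simp: out_nbrs_def)
  moreover have "finite (N\<^sub>1 H s)" "finite (N\<^sub>1 G x)"
    using out_nbrs_subset orientationD(1) H G by (metis finite_subset)+
  ultimately have "card (N\<^sub>1 H s \<times> pverts G \<union> {s} \<times> N\<^sub>1 G x) =
      card (N\<^sub>1 H s \<times> pverts G) + card ({s} \<times> N\<^sub>1 G x)"
    using orientationD(1)[OF G] by (intro card_Un_disjoint) auto
  then show ?thesis
    by (simp add: out_nbrs_lex_product[OF assms] card_cartesian_product)
qed

text \<open>The subtraction on \<open>nat\<close> is exact, since \<open>s\<close> and its
  out-neighbours are \<open>card (N\<^sub>1 H s) + 1\<close> distinct vertices of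
  \<open>H\<close>.\<close>

lemma card_second_out_nbrs_lex_product_le:
  assumes "s \<in> pverts H" "x \<in> pverts G"
  shows "card (N\<^sub>2 (lex_product H G) (s, x)) \<le>
    (card (pverts H) - card (N\<^sub>1 H s) - 1) * card (pverts G) + card (N\<^sub>2 G x)"
proof -
  let ?A = "pverts H - N\<^sub>1 H s - {s}"
  have "s \<notin> N\<^sub>1 H s"
    using orientationD(4)[OF H] by (auto simp: out_nbrs_def)
  moreover have "finite (N\<^sub>1 H s)"
    using out_nbrs_subset[OF H] orientationD(1)[OF H] by (rule finite_subset)
  ultimately have A: "card ?A = card (pverts H) - card (N\<^sub>1 H s) - 1"
    using assms by (simp add: card_Diff_subset out_nbrs_subset[OF H])
  have "finite (N\<^sub>2 G x)"
    using second_out_nbrs_subset orientationD(1)[OF G] by (metis finite_subset)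
  then have "card (N\<^sub>2 (lex_product H G) (s, x)) \<le> card (?A \<times> pverts G \<union> {s} \<times> N\<^sub>2 G x)"
    using orientationD(1)[OF H] orientationD(1)[OF G] assms
    by (intro card_mono second_out_nbrs_lex_product_subset) auto
  also have "\<dots> \<le> card (?A \<times> pverts G) + card ({s} \<times> N\<^sub>2 G x)"
    by (rule card_Un_le)
  finally show ?thesis
    by (simp add: card_cartesian_product A)
qed

text \<open>By \<open>half\<close>, whole copies add at least as much to the first neighbourhood as
  to the bound on the second; strictness comes from the copy of \<open>G\<close> that contains the
  vertex.\<close>

lemma counterexample_lex_product:
  assumes "counterexample G"
    and half: "\<And>s. s \<in> pverts H \<Longrightarrow> card (pverts H) \<le> 2 * card (N\<^sub>1 H s) + 1"
  shows "counterexample (lex_product H G)"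
proof -
  have "card (N\<^sub>2 (lex_product H G) (s, x)) < card (N\<^sub>1 (lex_product H G) (s, x))"
    if sx: "s \<in> pverts H" "x \<in> pverts G" for s x
  proof -
    have "card (pverts H) - card (N\<^sub>1 H s) - 1 \<le> card (N\<^sub>1 H s)"
      using half[OF sx(1)] by simp
    then have "(card (pverts H) - card (N\<^sub>1 H s) - 1) * card (pverts G)
        \<le> card (N\<^sub>1 H s) * card (pverts G)"
      by (rule mult_le_mono1)
    moreover have "card (N\<^sub>2 G x) < card (N\<^sub>1 G x)"
      using assms(1) sx by (simp add: counterexample_def)
    ultimately show ?thesis
      using card_second_out_nbrs_lex_product_le[OF sx] card_out_nbrs_lex_product[OF sx] by linarith
  qed
  then show ?thesis
    using orientation_lex_product by (auto simp: counterexample_def pverts_lex_product)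
qed

end


section \<open>Rotational tournaments\<close>

text \<open>The arcs are those from \<open>s\<close> to \<open>s + 1, \<dots>, s + r\<close> modulo \<open>2 * r + 1\<close>; the disjunct
  \<open>t + r < s\<close> describes the ones that wrap around.\<close>

definition rotational_tournament :: "nat \<Rightarrow> nat pair_pre_digraph" where
  "rotational_tournament r = \<lparr>pverts = {..2 * r},
     parcs = {(s, t). s \<le> 2 * r \<and> t \<le> 2 * r \<and> (s < t \<and> t \<le> s + r \<or> t + r < s)}\<rparr>"

lemma pverts_rotational_tournament: "pverts (rotational_tournament r) = {..2 * r}"
  by (simp add: rotational_tournament_def)

text \<open>For \<open>s < t\<close> the arc goes from \<open>s\<close> to \<open>t\<close> if
  \<open>t - s \<le> r\<close>, and from \<open>t\<close> to \<open>s\<close> otherwise.\<close>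

lemma orientation_rotational_tournament: "orientation (rotational_tournament r)"
  by (rule orientationI) (auto simp: rotational_tournament_def)

lemma card_out_nbrs_rotational_tournament:
  assumes "s \<le> 2 * r"
  shows "card (N\<^sub>1 (rotational_tournament r) s) = r"
proof (cases "s \<le> r")
  case True
  then have "N\<^sub>1 (rotational_tournament r) s = {s<..s + r}"
    by (auto simp: out_nbrs_def rotational_tournament_def)
  then show ?thesis
    by simp
next
  case False
  \<comment> \<open>Now \<open>s + r\<close> exceeds the last vertex \<open>2 * r\<close>, so
    \<open>s - r\<close> of the out-neighbours wrap around to
    \<open>0, ..., s - r - 1\<close>.\<close>
  then have "N\<^sub>1 (rotational_tournament r) s = {s<..2 * r} \<union> {..<s - r}"
    using assms by (auto simp: out_nbrs_def rotational_tournament_def)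
  moreover have "card ({s<..2 * r} \<union> {..<s - r}) = (2 * r - s) + (s - r)"
    by (subst card_Un_disjoint) auto
  ultimately show ?thesis
    using False assms by simp
qed


section \<open>The infinite family\<close>

lemma counterexample_blow_up:
  fixes G :: "'a pair_pre_digraph"
  assumes "counterexample G"
  obtains F :: "nat pair_pre_digraph" where "counterexample F"
    and "card (pverts F) = (2 * r + 1) * card (pverts G)"
    and "r * card (pverts G) \<le> min_out_degree F"
proof -
  let ?T = "rotational_tournament r"
  let ?P = "lex_product ?T G"
  note G = counterexample_imp_orientation[OF assms]
  note T = orientation_rotational_tournament[of r]
  note P = orientation_lex_product[OF T G]
  \<comment> \<open>A finite vertex set embeds into \<open>nat\<close>, whatever the type
    \<open>'a\<close> is.\<close>
  obtain f :: "nat \<times> 'a \<Rightarrow> nat" where f: "inj_on f (pverts ?P)"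
    using finite_imp_inj_to_nat_seg[OF orientationD(1)[OF P]] by blast
  show thesis
  proof
    \<comment> \<open>The hypothesis \<open>half\<close> holds with equality:
      \<open>2 * r + 1\<close> vertices, each of out-degree \<open>r\<close>.\<close>
    have "counterexample ?P"
      using assms
      by (intro counterexample_lex_product T G)
        (simp_all add: pverts_rotational_tournament card_out_nbrs_rotational_tournament)
    then show "counterexample (relabel f ?P)"
      by (rule counterexample_relabel[OF P f])
    show "card (pverts (relabel f ?P)) = (2 * r + 1) * card (pverts G)"
      by (simp add: card_pverts_relabel[OF P f] pverts_lex_product pverts_rotational_tournament
          card_cartesian_product)
    \<comment> \<open>Only the \<open>r\<close> whole copies are counted; the out-degree within the
      own copy is dropped.\<close>
    have "r * card (pverts G) \<le> min_out_degree ?P"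
      by (rule min_out_degree_geI[OF P])
        (auto simp: pverts_lex_product card_out_nbrs_lex_product[OF T G]
          pverts_rotational_tournament card_out_nbrs_rotational_tournament)
    then show "r * card (pverts G) \<le> min_out_degree (relabel f ?P)"
      by (simp add: min_out_degree_relabel[OF P f])
  qed
qed

text \<open>The number of vertices is the invariant that separates the members of the
  family.\<close>

lemma digraph_iso_imp_card_pverts_eq:
  assumes "orientation G" "orientation H" "digraph_iso (with_proj G) (with_proj H)"
  shows "card (pverts G) = card (pverts H)"
proof -
  have "pair_wf_digraph G" "pair_wf_digraph H"
    using assms(1,2)
    by (auto simp: orientation_def pair_digraph_def pair_fin_digraph_def)
  then show ?thesis
    using assms(3) by (auto simp: digraph_iso_with_proj_iff intro: bij_betw_same_card)
qed

theorem corollary3p3: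
  assumes "\<not> seymour_conjecture TYPE('a)"
  shows "\<exists>k :: nat. \<exists>S :: nat pair_pre_digraph set.
    infinite S \<and>
    (\<forall>G \<in> S. \<forall>H \<in> S. G \<noteq> H \<longrightarrow> \<not> digraph_iso (with_proj G) (with_proj H)) \<and>
    (\<forall>G \<in> S. counterexample G \<and> real (min_out_degree G) \<ge> real (card (pverts G)) / 2 - real k)"
proof -
  obtain G :: "'a pair_pre_digraph" where G: "counterexample G"
    using assms not_seymour_conjecture_iff by blast
  define m where "m = card (pverts G)"
  have "m > 0"
    using orientationD(1,2)[OF counterexample_imp_orientation[OF G]]
    by (simp add: m_def card_gt_0_iff)
  have "\<forall>r. \<exists>F :: nat pair_pre_digraph. counterexample F \<and> card (pverts F) = (2 * r + 1) * m \<and>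
      r * m \<le> min_out_degree F"
    using counterexample_blow_up[OF G] unfolding m_def by metis
  then obtain F :: "nat \<Rightarrow> nat pair_pre_digraph" where F: "\<And>r. counterexample (F r)"
    and card_F: "\<And>r. card (pverts (F r)) = (2 * r + 1) * m"
    and deg_F: "\<And>r. r * m \<le> min_out_degree (F r)"
    by metis
  \<comment> \<open>As \<open>m > 0\<close>, the vertex count \<open>(2 * r + 1) * m\<close>
    determines \<open>r\<close>.\<close>
  have card_inj: "r = r'" if "card (pverts (F r)) = card (pverts (F r'))" for r r'
    using that \<open>m > 0\<close> by (simp add: card_F)
  show ?thesis
  \<comment> \<open>The witnesses stay schematic and are fixed below: \<open>range F\<close> for
    \<open>S\<close>, and \<open>m\<close> for \<open>k\<close>.\<close>
  proof (intro exI conjI)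
    have "inj F"
      by (rule injI) (metis card_inj)
    then show "infinite (range F)"
      by (rule range_inj_infinite)
    show "\<forall>G \<in> range F. \<forall>H \<in> range F. G \<noteq> H \<longrightarrow> \<not> digraph_iso (with_proj G) (with_proj H)"
      using card_inj digraph_iso_imp_card_pverts_eq F counterexample_imp_orientation by blast
    show "\<forall>G \<in> range F. counterexample G \<and>
        real (min_out_degree G) \<ge> real (card (pverts G)) / 2 - real m"
    proof clarify
      fix r
      \<comment> \<open>Half the vertex count is \<open>r * m + m / 2\<close>, so subtracting
        \<open>m\<close> more than removes the extra half copy.\<close>
      have "real (card (pverts (F r))) / 2 - real m \<le> real (r * m)"
        by (simp add: card_F field_simps)
      also have "\<dots> \<le> real (min_out_degree (F r))"
        using deg_F by (rule of_nat_mono)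
      finally show "counterexample (F r) \<and>
          real (min_out_degree (F r)) \<ge> real (card (pverts (F r))) / 2 - real m"
        using F by simp
    qed
  qed
qed

end
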